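(* As $n\to\infty$, $F_{\mathrm{bip}}(n)=\frac14\sqrt n+\frac38+o(1)$; that is, $\lim_{n\to\infty}\left(F_{\mathrm{bip}}(n)-\frac14\sqrt n\right)=\frac38$.
   Context: All graphs are finite and simple. For a graph $G$ with no isolated vertices (and at least one vertex), write $d_G(v)$ for the degree of $v$ and $N_G(v)$ for its neighbourhood. The global average degree of $G$ is $\overline d(G)=\frac{1}{|V(G)|}\sum_{v\in V(G)}d_G(v)=\frac{2|E(G)|}{|V(G)|}$. The local average degree at a vertex $v$ is $\widetilde d_G(v)=\frac{1}{d_G(v)}\sum_{u\in N_G(v)}d_G(u)$. Set $q(G)=\min_{v\in V(G)}\widetilde d_G(v)$. For an integer $n\ge 2$, define $$F_{\mathrm{bip}}(n)=\max_{G}\frac{q(G)}{\overline d(G)},$$ where the maximum is over all bipartite graphs $G$ (not necessarily connected) with $|V(G)|=n$ and no isolated vertices. *)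

theory Defs
  imports Complex_Main
begin

text \<open>A graph is given by its vertex set \<open>V\<close> and its set \<open>E\<close> of edges, each edge being a
  two-element subset of \<open>V\<close>.\<close>

definition simple_graph :: "'a set \<Rightarrow> 'a set set \<Rightarrow> bool" where
  "simple_graph V E \<longleftrightarrow> finite V \<and> (\<forall>e\<in>E. e \<subseteq> V \<and> card e = 2)"

definition nbhd :: "'a set set \<Rightarrow> 'a \<Rightarrow> 'a set" where
  "nbhd E v = {u. {v, u} \<in> E}"

definition vertex_degree :: "'a set set \<Rightarrow> 'a \<Rightarrow> nat" where
  "vertex_degree E v = card (nbhd E v)"

definition no_isolated :: "'a set \<Rightarrow> 'a set set \<Rightarrow> bool" where
  "no_isolated V E \<longleftrightarrow> (\<forall>v\<in>V. nbhd E v \<noteq> {})"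

definition bipartite :: "'a set \<Rightarrow> 'a set set \<Rightarrow> bool" where
  "bipartite V E \<longleftrightarrow>
     (\<exists>A B. A \<union> B = V \<and> A \<inter> B = {} \<and> (\<forall>e\<in>E. \<exists>a\<in>A. \<exists>b\<in>B. e = {a, b}))"

definition global_avg_degree :: "'a set \<Rightarrow> 'a set set \<Rightarrow> real" where
  "global_avg_degree V E = (\<Sum>v\<in>V. real (vertex_degree E v)) / real (card V)"

definition local_avg_degree :: "'a set set \<Rightarrow> 'a \<Rightarrow> real" where
  "local_avg_degree E v = (\<Sum>u\<in>nbhd E v. real (vertex_degree E u)) / real (vertex_degree E v)"

definition min_local_avg_degree :: "'a set \<Rightarrow> 'a set set \<Rightarrow> real" where
  "min_local_avg_degree V E = Min (local_avg_degree E ` V)"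

text \<open>Since every graph on \<open>n\<close> vertices is isomorphic to one whose vertices are natural numbers,
  it suffices to let \<open>V\<close> range over sets of natural numbers.\<close>

definition bip_ratios :: "nat \<Rightarrow> real set" where
  "bip_ratios n =
     {min_local_avg_degree V E / global_avg_degree V E | (V :: nat set) E.
        simple_graph V E \<and> card V = n \<and> bipartite V E \<and> no_isolated V E}"

definition F_bip :: "nat \<Rightarrow> real" where
  "F_bip n = Max (bip_ratios n)"

text \<open>For \<open>n \<ge> 2\<close> the maximum defining \<open>F_bip n\<close> exists: the set of ratios is finite and
  nonempty.  (For \<open>n < 2\<close> the value of \<open>F_bip n\<close> carries no meaning.)\<close>

lemma nbhd_subset: "simple_graph V E \<Longrightarrow> nbhd E v \<subseteq> V"
  by (auto simp: simple_graph_def nbhd_def)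

lemma vertex_degree_le_card: "simple_graph V E \<Longrightarrow> vertex_degree E v \<le> card V"
  unfolding vertex_degree_def by (rule card_mono) (auto simp: simple_graph_def nbhd_def)

lemma finite_bip_ratios:
  assumes "n \<ge> 2"
  shows "finite (bip_ratios n)"
proof (rule finite_subset)
  let ?f = "\<lambda>(s, d, m). (real s / real d) / (real m / real n)"
  show "finite (?f ` ({..n * n} \<times> {..n} \<times> {..n * n}))" by simp
  show "bip_ratios n \<subseteq> ?f ` ({..n * n} \<times> {..n} \<times> {..n * n})"
  proof
    fix x assume "x \<in> bip_ratios n"
    then obtain V :: "nat set" and E where
      x: "x = min_local_avg_degree V E / global_avg_degree V E"
      and G: "simple_graph V E" and n: "card V = n"
      unfolding bip_ratios_def by blast
    have fin: "finite V" using G by (simp add: simple_graph_def)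
    have ne: "V \<noteq> {}" using n assms by auto
    have "min_local_avg_degree V E \<in> local_avg_degree E ` V"
      unfolding min_local_avg_degree_def using fin ne by (intro Min_in) auto
    then obtain v where v: "v \<in> V" "min_local_avg_degree V E = local_avg_degree E v" by auto
    have le: "sum (vertex_degree E) A \<le> n * n" if "A \<subseteq> V" for A
    proof -
      have "sum (vertex_degree E) A \<le> card A * n"
        using sum_bounded_above[of A "vertex_degree E" n] vertex_degree_le_card[OF G] n by simp
      also have "\<dots> \<le> n * n" using card_mono[OF fin that] n by simp
      finally show ?thesis .
    qed
    have "x = ?f (sum (vertex_degree E) (nbhd E v), vertex_degree E v, sum (vertex_degree E) V)"
      by (simp add: x v(2) local_avg_degree_def global_avg_degree_def n)
    moreover have "(sum (vertex_degree E) (nbhd E v), vertex_degree E v, sum (vertex_degree E) V)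
        \<in> {..n * n} \<times> {..n} \<times> {..n * n}"
      using le[OF nbhd_subset[OF G]] le[of V] vertex_degree_le_card[OF G, of v] n by simp
    ultimately show "x \<in> ?f ` ({..n * n} \<times> {..n} \<times> {..n * n})" by blast
  qed
qed

lemma bip_ratios_nonempty:
  assumes "n \<ge> 2"
  shows "bip_ratios n \<noteq> {}"
proof -
  define V where "V = {..<n}"
  define E where "E = (\<lambda>i. {0, i}) ` {1..<n}"
  have "simple_graph V E" "card V = n"
    using assms by (auto simp: simple_graph_def V_def E_def)
  moreover have "bipartite V E"
    unfolding bipartite_def V_def E_def using assms
    by (intro exI[of _ "{0}"] exI[of _ "{1..<n}"]) auto
  moreover have "no_isolated V E"
    unfolding no_isolated_def
  proof
    fix v assume "v \<in> V"
    show "nbhd E v \<noteq> {}"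
    proof (cases "v = 0")
      case True
      have "{0, 1} \<in> E" using assms unfolding E_def by (intro image_eqI[of _ _ 1]) auto
      then show ?thesis using True by (auto simp: nbhd_def)
    next
      case False
      have "{v, 0} \<in> E" using \<open>v \<in> V\<close> False unfolding E_def V_def
        by (intro image_eqI[of _ _ v]) auto
      then show ?thesis by (auto simp: nbhd_def)
    qed
  qed
  ultimately show ?thesis unfolding bip_ratios_def by blast
qed

end

theory Submission
  imports Defs "HOL-Library.Landau_Symbols"
begin

text \<open>
  Write \<open>m\<close> for the number of edges, \<open>q\<close> for the minimum local average degree and \<open>d v\<close> for the
  degree of \<open>v\<close>, so that the ratio in question is \<open>q n / (2 m)\<close>.

  \<^bold>\<open>Upper bound.\<close> Since \<open>n\<close> is the sum of \<open>1 / d u + 1 / d v\<close> over all edges \<open>uv\<close>,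
  the quantity \<open>(1 + 1/q) m - n\<close> is the sum of \<open>1 + 1/q - 1/d u - 1/d v\<close> over all edges. No
  term is negative, because the neighbour of a leaf has degree at least \<open>q\<close>. Already the edges
  that meet the neighbourhood of a vertex of maximum degree contribute at least \<open>q (q - 1)\<close>; this is
  \<open>edge_excess_bound\<close>. Hence \<open>q n / (2 m) \<le> n (q + 1) / (2 (n + q\<^sup>2 - q))\<close>, and maximising over
  \<open>q\<close> gives at most \<open>n / (4 sqrt n - 6)\<close>, which is \<open>sqrt n / 4 + 3/8 + o(1)\<close>.

  \<^bold>\<open>Lower bound.\<close> Take a complete bipartite graph between sets of \<open>a\<close> and \<open>b\<close> vertices, hang
  \<open>x\<close> leaves on each vertex of the first set and \<open>y\<close> on each of the second, and put
  \<open>D = b + x\<close>, \<open>d = a + y\<close>. The local averages at the core vertices are \<open>1 + b (d - 1) / D\<close> and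
  \<open>1 + a (D - 1) / d\<close>, and the construction is good when these two nearly agree. The shape
  \<open>a = 2 sqrt n\<close>, \<open>b = sqrt n / 2\<close>, \<open>x = sqrt n / 2\<close>, \<open>y = 0\<close> meets the upper bound up to \<open>o(1)\<close>,
  but being integers, such parameters reach only some values of \<open>n\<close>. What rescues the remaining
  \<open>n\<close> is that this shape belongs to a one-parameter family, indexed by \<open>lam = b / sqrt n\<close>, all of whose members
  have the leading term \<open>sqrt n / 4\<close>, with a constant term \<open>(2 + lam + 1 / lam) / 12\<close> that tends
  to \<open>3/8\<close> as \<open>lam\<close> decreases to \<open>1/2\<close>.
  For \<open>lam\<close> slightly above \<open>1/2\<close> there are two changes of \<open>(a, b, x, y)\<close> by small integers that
  act as fine tuning. One changes the discrepancy of the two local averages by a small amount.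
  The other changes the number of vertices by a small multiple of \<open>sqrt n\<close> and keeps the
  discrepancy, provided that surplus leaves are dropped again so that \<open>n\<close> vertices remain. A
  bounded number of such changes therefore brings every large \<open>n\<close> within reach;
  \<open>bounded_core_parameters\<close> finds them, and \<open>F_bip_ge_eventually\<close> evaluates the
  result.
\<close>

section \<open>An edge-counting bound\<close>

lemma nbhd_sym: "u \<in> nbhd E v \<longleftrightarrow> v \<in> nbhd E u"
  by (simp add: nbhd_def insert_commute)

text \<open>
  The edges are summed along the side \<open>B\<close>: \<open>T u\<close> is the contribution of the edges at \<open>u \<in> B\<close>.
  For a neighbour \<open>u\<close> of the vertex \<open>w\<close> of maximum degree \<open>D\<close>, convexity bounds \<open>1 / t\<close> on
  \<open>[1, D]\<close> by its chord \<open>1 - (t - 1) / D\<close>, which makes \<open>T u\<close> linear in the degree sum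
  around \<open>u\<close>; that sum is at least \<open>q d(u)\<close>. Summing over the neighbours of \<open>w\<close> uses the
  local average condition once more, now at \<open>w\<close>, and all occurrences of \<open>D\<close> cancel.
\<close>

lemma edge_excess_bound:
  fixes q :: real
  assumes G: "simple_graph V E" and iso: "no_isolated V E"
    and AB: "A \<union> B = V" "A \<inter> B = {}" "\<forall>e\<in>E. \<exists>a\<in>A. \<exists>b\<in>B. e = {a, b}"
    and q: "q \<ge> 1" and loc: "\<And>v. v \<in> V \<Longrightarrow> q \<le> local_avg_degree E v"
    and w: "w \<in> A" and max: "\<And>v. v \<in> V \<Longrightarrow> vertex_degree E v \<le> vertex_degree E w"
  shows "real (card V) + q * (q - 1) \<le> (1 + 1 / q) * (\<Sum>v\<in>V. real (vertex_degree E v)) / 2"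
proof -
  define d where "d v = real (vertex_degree E v)" for v
  define N where "N = nbhd E"
  have finV: "finite V" using G by (simp add: simple_graph_def)
  have finA: "finite A" and finB: "finite B" using finV AB(1) by auto
  have NV: "N v \<subseteq> V" for v using nbhd_subset[OF G] by (simp add: N_def)
  have finN: "finite (N v)" for v using NV finV by (rule finite_subset)
  have NA: "N v \<subseteq> B" if "v \<in> A" for v
  proof
    fix u assume "u \<in> N v"
    then obtain a b where "a \<in> A" "b \<in> B" "{v, u} = {a, b}"
      using AB(3) unfolding N_def nbhd_def by blast
    then show "u \<in> B" using that AB(2) by (auto simp: doubleton_eq_iff)
  qed
  have NB: "N v \<subseteq> A" if "v \<in> B" for v
  proof
    fix u assume "u \<in> N v"
    then obtain a b where "a \<in> A" "b \<in> B" "{v, u} = {a, b}"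
      using AB(3) unfolding N_def nbhd_def by blast
    then show "u \<in> A" using that AB(2) by (auto simp: doubleton_eq_iff)
  qed
  have dN: "d v = real (card (N v))" for v by (simp add: d_def N_def vertex_degree_def)
  have d1: "d v \<ge> 1" if "v \<in> V" for v
  proof -
    have "N v \<noteq> {}" using iso that by (simp add: no_isolated_def N_def)
    then have "card (N v) \<ge> 1" using finN[of v] by (simp add: Suc_le_eq card_gt_0_iff)
    then show ?thesis by (simp add: dN)
  qed
  have loc': "q * d v \<le> (\<Sum>u\<in>N v. d u)" if "v \<in> V" for v
    using loc[OF that] d1[OF that]
    by (simp add: local_avg_degree_def d_def N_def pos_le_divide_eq)
  have swap: "(\<Sum>p\<in>A. \<Sum>u\<in>N p. g p u) = (\<Sum>u\<in>B. \<Sum>p\<in>N u. g p u)" for g :: "'a \<Rightarrow> 'a \<Rightarrow> real"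
  proof -
    have "(\<Sum>p\<in>A. \<Sum>u\<in>N p. g p u) = (\<Sum>p\<in>A. \<Sum>u\<in>{u\<in>B. u \<in> N p}. g p u)"
      using NA by (intro sum.cong refl) auto
    also have "\<dots> = (\<Sum>u\<in>B. \<Sum>p\<in>{p\<in>A. u \<in> N p}. g p u)"
      by (rule sum.swap_restrict[OF finA finB])
    also have "\<dots> = (\<Sum>u\<in>B. \<Sum>p\<in>N u. g p u)"
    proof (intro sum.cong refl)
      fix u assume "u \<in> B"
      show "{p\<in>A. u \<in> N p} = N u"
        using NB[OF \<open>u \<in> B\<close>] nbhd_sym[of u E] by (auto simp: N_def)
    qed
    finally show ?thesis .
  qed
  define m where "m = (\<Sum>u\<in>B. d u)"
  have split: "(\<Sum>v\<in>V. f v) = (\<Sum>v\<in>A. f v) + (\<Sum>v\<in>B. f v)" for f :: "'a \<Rightarrow> real"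
    using sum.union_disjoint[OF finA finB AB(2)] AB(1) by auto
  have "(\<Sum>v\<in>A. d v) = m"
    using swap[of "\<lambda>_ _. 1"] by (simp add: m_def dN)
  then have sumV: "(\<Sum>v\<in>V. d v) = 2 * m" by (simp add: split m_def)
  define T where "T u = (\<Sum>p\<in>N u. 1 + 1 / q - 1 / d u - 1 / d p)" for u
  have inv1: "(\<Sum>u\<in>N v. 1 / d v) = 1" if "v \<in> V" for v
    using d1[OF that] by (simp add: dN)
  have invS: "(\<Sum>p\<in>S. \<Sum>u\<in>N p. 1 / d p) = real (card S)" if "S \<subseteq> V" for S
  proof -
    have "(\<Sum>p\<in>S. \<Sum>u\<in>N p. 1 / d p) = (\<Sum>p\<in>S. 1)"
      using that by (intro sum.cong refl inv1) auto
    then show ?thesis by simp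
  qed
  have "card V = card A + card B"
    using card_Un_disjoint[OF finA finB AB(2)] AB(1) by simp
  then have cV: "real (card V) = (\<Sum>u\<in>B. \<Sum>p\<in>N u. 1 / d p) + (\<Sum>u\<in>B. \<Sum>p\<in>N u. 1 / d u)"
    using swap[of "\<lambda>p u. 1 / d p"] invS[of A] invS[of B] AB(1) by auto
  have "(\<Sum>u\<in>B. T u) = (\<Sum>u\<in>B. \<Sum>p\<in>N u. 1 + 1 / q)
      - (\<Sum>u\<in>B. \<Sum>p\<in>N u. 1 / d u) - (\<Sum>u\<in>B. \<Sum>p\<in>N u. 1 / d p)"
    by (simp only: T_def sum_subtractf)
  also have "(\<Sum>u\<in>B. \<Sum>p\<in>N u. 1 + 1 / q) = (1 + 1 / q) * m"
    unfolding m_def sum_distrib_left dN by (intro sum.cong) simp_all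
  finally have sumT: "(\<Sum>u\<in>B. T u) = (1 + 1 / q) * m - real (card V)"
    using cV by simp
  \<comment> \<open>An edge at a leaf has its other end of degree at least \<open>q\<close>; any other edge has both
    reciprocals at most \<open>1/2\<close>.\<close>
  have T0: "T u \<ge> 0" if "u \<in> B" for u
    unfolding T_def
  proof (rule sum_nonneg)
    fix p assume p: "p \<in> N u"
    have uV: "u \<in> V" and pV: "p \<in> V" using that AB(1) NV p by auto
    have leaf: "d b \<ge> q" if "d a = 1" "b \<in> N a" "a \<in> V" for a b
    proof -
      have "card (N a) = 1" using that(1) by (simp add: dN)
      then have "N a = {b}" using that(2) by (metis card_1_singletonE singletonD)
      then show ?thesis using loc'[OF that(3)] that(1) by simp
    qed
    have inv: "1 / d b \<le> 1 / q" if "d b \<ge> q" for b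
      using that q by (intro divide_left_mono mult_pos_pos) auto
    have two: "1 / d b \<le> 1 / 2" if "d b \<noteq> 1" "b \<in> V" for b
    proof -
      have "vertex_degree E b \<noteq> 1" "vertex_degree E b \<ge> 1" using that d1[of b] by (auto simp: d_def)
      then have "d b \<ge> 2" by (simp add: d_def)
      then show ?thesis by (simp add: field_simps)
    qed
    have up: "u \<in> N p" using p nbhd_sym[of u E p] by (simp add: N_def)
    have q0: "1 / q > 0" using q by simp
    consider "d u = 1" | "d p = 1" | "d u \<noteq> 1" "d p \<noteq> 1" by blast
    then show "0 \<le> 1 + 1 / q - 1 / d u - 1 / d p"
    proof cases
      case 1 then show ?thesis using inv[OF leaf[OF 1 p uV]] by simp
    next
      case 2 then show ?thesis using inv[OF leaf[OF 2 up pV]] by simp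
    next
      case 3 then show ?thesis using two[OF _ uV] two[OF _ pV] q0 by linarith
    qed
  qed
  have wV: "w \<in> V" using w AB(1) by auto
  define D where "D = d w"
  have D1: "D \<ge> 1" using d1[OF wV] by (simp add: D_def)
  have chord: "1 / d p \<le> 1 - (d p - 1) / D" if "p \<in> V" for p
  proof -
    have "d p \<ge> 1" "d p \<le> D" using d1[OF that] max[OF that] by (auto simp: d_def D_def)
    then have "0 \<le> (d p - 1) * (D - d p)" by simp
    then show ?thesis using \<open>d p \<ge> 1\<close> D1 by (simp add: field_simps)
  qed
  have Tw: "T u \<ge> d u * (1 / q + (q - 1) / D) - 1" if "u \<in> N w" for u
  proof -
    have uV: "u \<in> V" using that NV by auto
    have "d u * (1 / q + (q - 1) / D) - 1 \<le> d u / q - 1 + ((\<Sum>p\<in>N u. d p) - d u) / D"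
      using loc'[OF uV] D1 by (simp add: field_simps)
    also have "\<dots> = (\<Sum>p\<in>N u. 1 + 1 / q - 1 / d u - (1 - (d p - 1) / D))"
      using d1[OF uV]
      by (simp add: sum.distrib sum_subtractf sum_divide_distrib[symmetric] dN[symmetric] diff_divide_distrib)
    also have "\<dots> \<le> T u"
      unfolding T_def using chord NV by (intro sum_mono) force
    finally show ?thesis .
  qed
  have "q * (q - 1) = q * D * (1 / q + (q - 1) / D) - D"
    using q D1 by (simp add: field_simps)
  also have "\<dots> \<le> (\<Sum>u\<in>N w. d u) * (1 / q + (q - 1) / D) - D"
    using loc'[OF wV] q D1 by (intro diff_right_mono mult_right_mono) (auto simp: D_def)
  also have "\<dots> = (\<Sum>u\<in>N w. d u * (1 / q + (q - 1) / D) - 1)"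
    by (simp add: sum_subtractf sum_distrib_right D_def dN)
  also have "\<dots> \<le> (\<Sum>u\<in>N w. T u)" by (intro sum_mono Tw)
  also have "\<dots> \<le> (\<Sum>u\<in>B. T u)" using NA[OF w] finB T0 by (intro sum_mono2) auto
  also have "\<dots> = (1 + 1 / q) * m - real (card V)" by (rule sumT)
  finally show ?thesis using sumV by (simp add: d_def)
qed

text \<open>
  After \<open>edge_excess_bound\<close>, the optimisation over \<open>q\<close> is the inequality
  \<open>n + q (q - 1) \<ge> (2 sqrt n - 3) (q + 1)\<close>, that is, completing a square around
  \<open>q + 1 = sqrt n\<close>.
\<close>

lemma bip_ratio_le:
  assumes "r \<in> bip_ratios n" and n: "n \<ge> 3"
  shows "r \<le> real n / (4 * sqrt (real n) - 6)"
proof -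
  obtain V :: "nat set" and E where r: "r = min_local_avg_degree V E / global_avg_degree V E"
    and G: "simple_graph V E" and cV: "card V = n" and bip: "bipartite V E" and iso: "no_isolated V E"
    using assms(1) unfolding bip_ratios_def by blast
  obtain A B where AB: "A \<union> B = V" "A \<inter> B = {}" "\<forall>e\<in>E. \<exists>a\<in>A. \<exists>b\<in>B. e = {a, b}"
    using bip unfolding bipartite_def by blast
  have BA: "B \<union> A = V" "B \<inter> A = {}" "\<forall>e\<in>E. \<exists>a\<in>B. \<exists>b\<in>A. e = {a, b}"
    using AB by (auto simp: insert_commute; metis insert_commute)+
  have finV: "finite V" using G by (simp add: simple_graph_def)
  have ne: "V \<noteq> {}" using cV n by auto
  have d1: "vertex_degree E v \<ge> 1" if "v \<in> V" for v
  proof -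
    have "nbhd E v \<noteq> {}" "finite (nbhd E v)"
      using iso that finite_subset[OF nbhd_subset[OF G] finV] by (auto simp: no_isolated_def)
    then show ?thesis by (simp add: vertex_degree_def Suc_le_eq card_gt_0_iff)
  qed
  define q where "q = min_local_avg_degree V E"
  have loc: "q \<le> local_avg_degree E v" if "v \<in> V" for v
    unfolding q_def min_local_avg_degree_def using finV that by simp
  have "local_avg_degree E v \<ge> 1" if "v \<in> V" for v
  proof -
    have "(\<Sum>u\<in>nbhd E v. 1) \<le> (\<Sum>u\<in>nbhd E v. real (vertex_degree E u))"
      using d1 nbhd_subset[OF G, of v] by (intro sum_mono) force
    then show ?thesis using d1[OF that]
      by (simp add: local_avg_degree_def vertex_degree_def)
  qed
  then have q1: "q \<ge> 1" unfolding q_def min_local_avg_degree_def using finV ne by simp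
  have "Max (vertex_degree E ` V) \<in> vertex_degree E ` V" using finV ne by (intro Max_in) auto
  then obtain w where w: "w \<in> V" "Max (vertex_degree E ` V) = vertex_degree E w" by auto
  have max: "vertex_degree E v \<le> vertex_degree E w" if "v \<in> V" for v
    using that finV w(2)[symmetric] by simp
  define M where "M = (\<Sum>v\<in>V. real (vertex_degree E v))"
  have "real (card V) + q * (q - 1) \<le> (1 + 1 / q) * M / 2"
    using edge_excess_bound[OF G iso AB q1 loc _ max] edge_excess_bound[OF G iso BA q1 loc _ max] w(1) AB(1)
    unfolding M_def by blast
  then have key: "2 * q * (n + q * (q - 1)) \<le> (q + 1) * M"
    using q1 cV by (simp add: field_simps)
  define s where "s = sqrt (real n)"
  have s2: "s * s = n" by (simp add: s_def)
  have s32: "2 * s > 3"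
  proof -
    have "sqrt 3 \<le> s" using n by (simp add: s_def)
    moreover have "sqrt 3 > 3 / 2" by (rule real_less_rsqrt) (simp add: power2_eq_square)
    ultimately show ?thesis by simp
  qed
  have "(2 * s - 3) * (q + 1) \<le> n + q * (q - 1)"
  proof -
    have "n + q * (q - 1) - (2 * s - 3) * (q + 1) = (q + 1 - s)\<^sup>2 + 2"
      by (simp add: power2_eq_square algebra_simps s2[symmetric])
    then show ?thesis by (smt (verit) zero_le_power2)
  qed
  then have "2 * q * ((2 * s - 3) * (q + 1)) \<le> (q + 1) * M"
    using key q1 by (smt (verit) mult_left_mono)
  then have "(q + 1) * (q * (4 * s - 6)) \<le> (q + 1) * M" by (simp add: algebra_simps)
  then have qM: "q * (4 * s - 6) \<le> M" using q1 by simp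
  have M0: "M > 0" using qM q1 s32 by (smt (verit) mult_pos_pos)
  have "r = q * n / M" by (simp add: r q_def M_def global_avg_degree_def cV)
  also have "\<dots> \<le> n / (4 * s - 6)"
  proof -
    have "n * (q * (4 * s - 6)) \<le> n * M" using qM by (intro mult_left_mono) auto
    then show ?thesis using M0 s32 by (simp add: field_simps)
  qed
  finally show ?thesis by (simp add: s_def)
qed

lemma F_bip_le: "n \<ge> 3 \<Longrightarrow> F_bip n \<le> real n / (4 * sqrt (real n) - 6)"
  unfolding F_bip_def using bip_ratio_le finite_bip_ratios bip_ratios_nonempty by (subst Max_le_iff) auto

lemma F_bip_minus_sqrt_lt:
  assumes "u > 3 / 8"
  shows "\<forall>\<^sub>F n in sequentially. F_bip n - sqrt (real n) / 4 < u"
proof -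
  have "filterlim (\<lambda>n. sqrt (real n)) at_top sequentially"
    by (intro filterlim_compose[OF sqrt_at_top] filterlim_real_sequentially)
  then have "\<forall>\<^sub>F n in sequentially. sqrt (real n) \<ge> max 2 (6 + 9 / (u - 3 / 8))"
    unfolding filterlim_at_top by blast
  then show ?thesis using eventually_ge_at_top[of 3]
  proof eventually_elim
    case (elim n)
    define s where "s = sqrt (real n)"
    have s: "s \<ge> 2" "s - 6 \<ge> 9 / (u - 3 / 8)" and s2: "real n = s * s"
      using elim(1) by (auto simp: s_def)
    have "9 \<le> (s - 6) * (u - 3 / 8)" using s(2) assms by (simp add: pos_divide_le_eq)
    also have "\<dots> < 4 * (4 * s - 6) * (u - 3 / 8)" using s(1) assms by (intro mult_strict_right_mono) auto
    finally have "s * s < (u + s / 4) * (4 * s - 6)" by (simp add: algebra_simps)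
    then have "s * s / (4 * s - 6) < u + s / 4" using s(1) by (simp add: pos_divide_less_eq)
    moreover have "F_bip n \<le> s * s / (4 * s - 6)"
      using F_bip_le[OF elim(2)] unfolding s_def[symmetric] unfolding s2 .
    ultimately show ?case unfolding s_def[symmetric] by linarith
  qed
qed

section \<open>Complete bipartite graphs with pendant leaves\<close>

lemma card_residue_class:
  fixes a :: nat
  assumes "i < a"
  shows "card {k. k < a * t \<and> k mod a = i} = t"
proof -
  have "{k. k < a * t \<and> k mod a = i} = (\<lambda>s. s * a + i) ` {..<t}"
  proof (intro equalityI subsetI)
    fix k assume "k \<in> {k. k < a * t \<and> k mod a = i}"
    then have "k = k div a * a + i" "k div a < t"
      by (auto simp: less_mult_imp_div_less mult.commute)
    then show "k \<in> (\<lambda>s. s * a + i) ` {..<t}" by blast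
  next
    fix k assume "k \<in> (\<lambda>s. s * a + i) ` {..<t}"
    then obtain s where s: "s < t" "k = s * a + i" by auto
    then have "Suc s * a \<le> t * a" by (intro mult_right_mono) auto
    then show "k \<in> {k. k < a * t \<and> k mod a = i}" using s assms by (auto simp: mult.commute)
  qed
  moreover have "inj_on (\<lambda>s. s * a + i) {..<t}" using assms by (auto simp: inj_on_def)
  ultimately show ?thesis by (simp add: card_image)
qed

text \<open>
  The two products in the hypotheses say that the local averages at the core vertices are at
  least \<open>Q\<close>, and the two lower bounds on degrees serve the leaves. To reach \<open>n\<close> exactly, some
  vertices of the first core set carry \<open>x - 1\<close> instead of \<open>x\<close> leaves. This only raises their own
  average, and it lowers the degree sum seen from the second core set by the number of omitted
  leaves, the last bracket in the last hypothesis. The edges are the \<open>a b\<close> core edges and one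
  for each of the \<open>n - a - b\<close> leaves.
\<close>

lemma F_bip_ge:
  fixes a b x y n :: nat and Q :: real
  assumes a: "a \<ge> 1" and b: "b \<ge> 1" and x: "x \<ge> 1"
    and lo: "a + b + a * (x - 1) + b * y \<le> n" and hi: "n \<le> a + b + a * x + b * y"
    and Q: "Q \<ge> 1" "Q \<le> real b + real x - 1" "Q \<le> real a + real y"
    and QA: "(Q - 1) * (real b + real x) \<le> real b * (real a + real y - 1)"
    and QB: "(Q - 1) * (real a + real y) \<le>
      real a * (real b + real x - 1) - (real a + real b + real a * real x + real b * real y - real n)"
  shows "Q * n / (2 * (real n + real a * real b - real a - real b)) \<le> F_bip n"
proof -
  define L where "L = n - (a + b + b * y)"
  have nL: "n = a + b + b * y + L" and L: "a * (x - 1) \<le> L" "L \<le> a * x"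
    using lo hi by (auto simp: L_def)
  \<comment> \<open>Core vertices are numbered first. Consecutive leaves go cyclically round the second core set
    until each vertex there has \<open>y\<close> of them, and then cyclically round the first.\<close>
  define par where "par l = (if l < a + b + b * y then a + (l - (a + b)) mod b
    else (l - (a + b + b * y)) mod a)" for l
  define Lv where "Lv = {a + b..<n}"
  define leaves where "leaves v = {l \<in> Lv. par l = v}" for v
  define V where "V = {..<n}"
  define E where "E = {{i, j} | i j. i < a \<and> a \<le> j \<and> j < a + b} \<union> {{l, par l} | l. l \<in> Lv}"
  have par: "par l < a + b" for l
    using a b by (auto simp: par_def intro: less_le_trans[OF mod_less_divisor])
  have mem_E: "{u, v} \<in> E \<longleftrightarrow> (u < a \<and> a \<le> v \<and> v < a + b) \<or> (v < a \<and> a \<le> u \<and> u < a + b)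
      \<or> (u \<in> Lv \<and> v = par u) \<or> (v \<in> Lv \<and> u = par v)" for u v
    unfolding E_def Un_iff mem_Collect_eq doubleton_eq_iff by blast
  have nbA: "nbhd E i = {a..<a + b} \<union> leaves i" if "i < a" for i
    using that by (auto simp: nbhd_def mem_E leaves_def Lv_def)
  have nbB: "nbhd E j = {..<a} \<union> leaves j" if "a \<le> j" "j < a + b" for j
    using that by (auto simp: nbhd_def mem_E leaves_def Lv_def)
  have nbL: "nbhd E l = {par l}" if "l \<in> Lv" for l
  proof -
    have "par k \<noteq> l" for k using par[of k] that by (auto simp: Lv_def)
    then show ?thesis using that by (auto simp: nbhd_def mem_E Lv_def)
  qed
  have fin: "finite (leaves v)" for v by (auto simp: leaves_def Lv_def)
  have lvB: "card (leaves j) = y" if "a \<le> j" "j < a + b" for j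
  proof -
    have "leaves j = (\<lambda>k. k + (a + b)) ` {k. k < b * y \<and> k mod b = j - a}"
    proof (intro equalityI subsetI)
      fix l assume l: "l \<in> leaves j"
      have "l < a + b + b * y"
      proof (rule ccontr)
        assume "\<not> l < a + b + b * y"
        then have "par l < a" using a by (simp add: par_def)
        then show False using l that by (simp add: leaves_def)
      qed
      then show "l \<in> (\<lambda>k. k + (a + b)) ` {k. k < b * y \<and> k mod b = j - a}"
        using l by (intro image_eqI[of _ _ "l - (a + b)"]) (auto simp: leaves_def Lv_def par_def)
    qed (use that nL in \<open>auto simp: leaves_def Lv_def par_def\<close>)
    then show ?thesis using card_residue_class[of "j - a" b y] that by (simp add: card_image)
  qed
  have lvA: "card (leaves i) = card {k. k < L \<and> k mod a = i}" if "i < a" for i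
  proof -
    have "leaves i = (\<lambda>k. k + (a + b + b * y)) ` {k. k < L \<and> k mod a = i}"
    proof (intro equalityI subsetI)
      fix l assume l: "l \<in> leaves i"
      have "\<not> l < a + b + b * y"
        using l that by (auto simp: leaves_def par_def)
      then show "l \<in> (\<lambda>k. k + (a + b + b * y)) ` {k. k < L \<and> k mod a = i}"
        using l nL by (intro image_eqI[of _ _ "l - (a + b + b * y)"]) (auto simp: leaves_def Lv_def par_def)
    qed (use that nL in \<open>auto simp: leaves_def Lv_def par_def\<close>)
    then show ?thesis by (simp add: card_image)
  qed
  have lvA_le: "card (leaves i) \<le> x" if "i < a" for i
  proof -
    have "card {k. k < L \<and> k mod a = i} \<le> card {k. k < a * x \<and> k mod a = i}"
      using L(2) by (intro card_mono) auto
    then show ?thesis using lvA[OF that] card_residue_class[OF that] by simp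
  qed
  have lvA_ge: "x - 1 \<le> card (leaves i)" if "i < a" for i
  proof -
    have "card {k. k < a * (x - 1) \<and> k mod a = i} \<le> card {k. k < L \<and> k mod a = i}"
      using L(1) by (intro card_mono) auto
    then show ?thesis using lvA[OF that] card_residue_class[OF that] by simp
  qed
  have sum_lvA: "(\<Sum>i<a. card (leaves i)) = L"
  proof -
    have "(\<Sum>i<a. card (leaves i)) = (\<Sum>i<a. \<Sum>k\<in>{k \<in> {..<L}. k mod a = i}. 1)"
      by (intro sum.cong refl) (simp add: lvA)
    also have "\<dots> = (\<Sum>k<L. 1)" using a by (intro sum.group) auto
    finally show ?thesis by simp
  qed
  define d where "d v = real (vertex_degree E v)" for v
  have dA: "d i = b + card (leaves i)" if "i < a" for i
    unfolding d_def vertex_degree_def nbA[OF that]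
    by (subst card_Un_disjoint) (auto simp: fin leaves_def Lv_def)
  have dB: "d j = a + y" if "a \<le> j" "j < a + b" for j
    unfolding d_def vertex_degree_def nbB[OF that] using lvB[OF that]
    by (subst card_Un_disjoint) (auto simp: fin leaves_def Lv_def)
  have dL: "d l = 1" if "l \<in> Lv" for l
    by (simp add: d_def vertex_degree_def nbL[OF that])
  have sumA: "(\<Sum>i<a. d i) = real a * real b + L"
    using sum_lvA by (simp add: dA sum.distrib flip: of_nat_sum)
  have sumB: "(\<Sum>j\<in>{a..<a + b}. d j) = real b * (real a + real y)"
    by (simp add: dB algebra_simps)
  have sumlv: "(\<Sum>l\<in>leaves v. d l) = card (leaves v)" for v
    using dL by (simp add: leaves_def)
  have "V = ({..<a} \<union> {a..<a + b}) \<union> Lv" using nL by (auto simp: V_def Lv_def)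
  then have "(\<Sum>v\<in>V. d v) = (\<Sum>v<a. d v) + (\<Sum>v\<in>{a..<a + b}. d v) + (\<Sum>v\<in>Lv. d v)"
    by (simp add: sum.union_disjoint Lv_def ivl_disj_int disjoint_iff)
  also have "(\<Sum>v\<in>Lv. d v) = real n - real a - real b" using dL nL by (simp add: Lv_def)
  finally have sumV: "(\<Sum>v\<in>V. d v) = 2 * (real n + real a * real b - real a - real b)"
    using nL by (simp add: sumA sumB algebra_simps)
  have "l \<noteq> par l" "par l < n" if "l \<in> Lv" for l
    using par[of l] that by (auto simp: Lv_def)
  then have G: "simple_graph V E"
    using nL by (auto simp: simple_graph_def V_def E_def Lv_def)
  have iso: "no_isolated V E"
    unfolding no_isolated_def
  proof
    fix v assume "v \<in> V"
    then have "v < a \<or> a \<le> v \<and> v < a + b \<or> v \<in> Lv" by (auto simp: V_def Lv_def)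
    then consider "v < a" | "a \<le> v" "v < a + b" | "v \<in> Lv" by blast
    then show "nbhd E v \<noteq> {}"
      using a b by cases (auto simp: nbA nbB nbL lessThan_empty_iff)
  qed
  have bip: "bipartite V E"
    unfolding bipartite_def
  proof (intro exI conjI)
    show "({..<a} \<union> {l\<in>Lv. a \<le> par l}) \<union> ({a..<a + b} \<union> {l\<in>Lv. par l < a}) = V"
      using nL by (auto simp: V_def Lv_def)
    show "({..<a} \<union> {l\<in>Lv. a \<le> par l}) \<inter> ({a..<a + b} \<union> {l\<in>Lv. par l < a}) = {}"
      by (auto simp: Lv_def)
    show "\<forall>e\<in>E. \<exists>p\<in>{..<a} \<union> {l\<in>Lv. a \<le> par l}. \<exists>r\<in>{a..<a + b} \<union> {l\<in>Lv. par l < a}. e = {p, r}"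
    proof
      fix e assume "e \<in> E"
      then consider i j where "e = {i, j}" "i < a" "a \<le> j" "j < a + b"
        | l where "e = {l, par l}" "l \<in> Lv" "a \<le> par l" | l where "e = {par l, l}" "l \<in> Lv" "par l < a"
        unfolding E_def by (fastforce simp: insert_commute)
      then show "\<exists>p\<in>{..<a} \<union> {l\<in>Lv. a \<le> par l}. \<exists>r\<in>{a..<a + b} \<union> {l\<in>Lv. par l < a}. e = {p, r}"
      proof cases
        case 1
        then show ?thesis by (intro bexI[of _ i] bexI[of _ j]) auto
      next
        case 2
        then show ?thesis using par[of l] by (intro bexI[of _ l] bexI[of _ "par l"]) auto
      next
        case 3
        then show ?thesis by (intro bexI[of _ "par l"] bexI[of _ l]) auto
      qed
    qed
  qed
  have loc: "Q \<le> local_avg_degree E v" if v: "v \<in> V" for v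
  proof -
    have eq: "local_avg_degree E v = (\<Sum>u\<in>nbhd E v. d u) / d v"
      by (simp add: local_avg_degree_def d_def)
    have "v < a \<or> a \<le> v \<and> v < a + b \<or> v \<in> Lv" using v by (auto simp: V_def Lv_def)
    then consider "v < a" | "a \<le> v" "v < a + b" | "v \<in> Lv" by blast
    then show ?thesis
    proof cases
      case 1
      have "(\<Sum>u\<in>nbhd E v. d u) = real b * (real a + real y) + card (leaves v)"
        unfolding nbA[OF 1] sumB[symmetric] sumlv[symmetric]
        by (rule sum.union_disjoint) (auto simp: fin leaves_def Lv_def)
      moreover have "(Q - 1) * (real b + card (leaves v)) \<le> (Q - 1) * (real b + real x)"
        using lvA_le[OF 1] Q by (intro mult_left_mono) auto
      ultimately have "Q * d v \<le> (\<Sum>u\<in>nbhd E v. d u)"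
        using QA by (simp add: dA[OF 1] algebra_simps)
      then show ?thesis using b by (simp add: eq dA[OF 1] pos_le_divide_eq)
    next
      case 2
      have "(\<Sum>u\<in>nbhd E v. d u) = real a * real b + L + y"
        unfolding nbB[OF 2] sumA[symmetric] lvB[OF 2, symmetric] sumlv[symmetric]
        by (rule sum.union_disjoint) (auto simp: fin leaves_def Lv_def)
      then have "Q * d v \<le> (\<Sum>u\<in>nbhd E v. d u)"
        using QB nL by (simp add: dB[OF 2] algebra_simps)
      then show ?thesis using a by (simp add: eq dB[OF 2] pos_le_divide_eq)
    next
      case 3
      have "Q \<le> d (par v)"
      proof (cases "par v < a")
        case True
        then show ?thesis using lvA_ge[OF True] Q(2) x by (simp add: dA)
      next
        case False
        then show ?thesis using Q(3) par[of v] by (simp add: dB)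
      qed
      then show ?thesis by (simp add: eq nbL[OF 3] dL[OF 3])
    qed
  qed
  have n2: "n \<ge> 2" using nL a b by simp
  have "Q \<le> min_local_avg_degree V E"
    unfolding min_local_avg_degree_def using loc n2 by (subst Min_ge_iff) (auto simp: V_def lessThan_empty_iff)
  moreover have "(\<Sum>v\<in>V. d v) \<ge> 0" by (simp add: d_def sum_nonneg)
  ultimately have "Q * n / (\<Sum>v\<in>V. d v) \<le> min_local_avg_degree V E / global_avg_degree V E"
    unfolding global_avg_degree_def d_def[symmetric]
    by (simp add: V_def divide_right_mono mult_right_mono)
  also have "\<dots> \<le> F_bip n"
  proof -
    have "min_local_avg_degree V E / global_avg_degree V E \<in> bip_ratios n"
      unfolding bip_ratios_def mem_Collect_eq using G iso bip
      by (intro exI[of _ V] exI[of _ E]) (simp add: V_def)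
    then show ?thesis unfolding F_bip_def using finite_bip_ratios[OF n2] by simp
  qed
  finally show ?thesis unfolding sumV .
qed

section \<open>Tuning the parameters for every large order\<close>

lemma floor_minus_bigo_1:
  fixes f :: "nat \<Rightarrow> real"
  shows "(\<lambda>n. of_int \<lfloor>f n\<rfloor> - f n) \<in> O(\<lambda>_. 1)"
proof (rule bigoI[of _ 1], intro always_eventually allI)
  fix n show "norm (of_int \<lfloor>f n\<rfloor> - f n) \<le> 1 * norm (1 :: real)"
    using floor_correct[of "f n"] by (simp, linarith)
qed

text \<open>
  The parameters of the core are \<open>al N\<close>, \<open>lam N\<close>, \<open>xi N\<close>, \<open>ka N\<close>, for \<open>a\<close>, \<open>b\<close>, \<open>x\<close>, \<open>d\<close>, up
  to bounded corrections \<open>a1\<close>, \<open>b1\<close>, \<open>x1\<close>, \<open>d1\<close>. Here \<open>N = sqrt n\<close>, and the coefficients are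
  chosen such that in the equations \<open>b d = N D\<close>, \<open>a D = N d\<close> and \<open>a D + b d - 2 a b = n\<close>, with
  \<open>D = b + x\<close>, the leading terms agree. Two quantities of the next order remain to be
  controlled. The first, kept in \<open>[0, 4 lam - al]\<close>, is \<open>ka\<close> times the excess of the local
  average at the first core set over the one at the second, to leading order and after surplus
  leaves on the first core set have been dropped to leave \<open>n\<close> vertices. The second, kept in
  \<open>[ka - al, 2 (ka - al)]\<close>, is the coefficient of \<open>N\<close> in the number of those surplus leaves.

  Replacing \<open>(a, x)\<close> by \<open>(a + 2, x - 1)\<close> with \<open>d\<close> fixed lowers the first quantity by exactly
  \<open>4 lam - al\<close>. The first quantity does not depend on \<open>b1\<close>, and increasing \<open>b\<close> by one raises
  the second by \<open>ka - al\<close>. So \<open>a\<close> and \<open>x\<close> are settled first, and then \<open>b\<close>. Both step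
  lengths vanish at \<open>lam = 1/2\<close>, which makes the final loss as small as desired.
\<close>

lemma bounded_core_parameters:
  fixes lam al ka xi :: real and N :: "nat \<Rightarrow> real"
  assumes lam: "1 / 2 < lam" "lam < 1"
    and al_def: "al = 1 / lam" and ka_def: "ka = 3 / (1 + lam)" and xi_def: "xi = lam * ka - lam"
  obtains a b x d :: "nat \<Rightarrow> int" and a1 b1 x1 d1 :: "nat \<Rightarrow> real"
  where "\<And>n. real_of_int (a n) = al * N n + a1 n" "\<And>n. real_of_int (b n) = lam * N n + b1 n"
    "\<And>n. real_of_int (x n) = xi * N n + x1 n" "\<And>n. real_of_int (d n) = ka * N n + d1 n"
    "a1 \<in> O(\<lambda>_. 1)" "b1 \<in> O(\<lambda>_. 1)" "x1 \<in> O(\<lambda>_. 1)" "d1 \<in> O(\<lambda>_. 1)"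
    "\<And>n. 0 \<le> (2 + lam) * d1 n - al * x1 n - 2 * lam * a1 n + 2 * al + lam - 1"
    "\<And>n. (2 + lam) * d1 n - al * x1 n - 2 * lam * a1 n + 2 * al + lam - 1 \<le> 4 * lam - al"
    "\<And>n. ka - al \<le> al * x1 n + xi * a1 n + lam * (d1 n - a1 n) + (ka - al) * b1 n + al + lam"
    "\<And>n. al * x1 n + xi * a1 n + lam * (d1 n - a1 n) + (ka - al) * b1 n + al + lam \<le> 2 * (ka - al)"
proof -
  define si where "si = 4 * lam - al"
  define et where "et = ka - al"
  have si: "si > 0"
  proof -
    have "1 < 4 * (lam * lam)" using mult_strict_mono[of "1/2" lam "1/2" lam] lam by simp
    then show ?thesis using lam by (simp add: si_def al_def field_simps)
  qed
  have et: "et > 0"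
  proof -
    have "1 / lam < 3 / (1 + lam)" using lam by (simp add: pos_divide_less_eq pos_less_divide_eq)
    then show ?thesis by (simp add: et_def ka_def al_def)
  qed
  note closure = landau_o.big.mult_in_1 sum_in_bigo
  define d where "d n = \<lfloor>ka * N n\<rfloor>" for n
  define d1 where "d1 n = of_int (d n) - ka * N n" for n
  have d1: "d1 \<in> O(\<lambda>_. 1)" unfolding d1_def d_def by (rule floor_minus_bigo_1)
  define x0 where "x0 n = of_int \<lfloor>xi * N n\<rfloor> - xi * N n" for n
  define a0 where "a0 n = of_int \<lfloor>al * N n\<rfloor> - al * N n" for n
  have x0: "x0 \<in> O(\<lambda>_. 1)" unfolding x0_def by (rule floor_minus_bigo_1)
  have a0: "a0 \<in> O(\<lambda>_. 1)" unfolding a0_def by (rule floor_minus_bigo_1)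
  define e0 where "e0 n = (2 + lam) * d1 n - al * x0 n - 2 * lam * a0 n + 2 * al + lam - 1" for n
  \<comment> \<open>The number of replacements of \<open>(a, x)\<close> by \<open>(a + 2, x - 1)\<close>; it may be negative.\<close>
  define k where "k n = \<lfloor>e0 n / si\<rfloor>" for n
  have e0: "(\<lambda>n. e0 n / si) \<in> O(\<lambda>_. 1)"
    unfolding e0_def divide_inverse by (intro closure d1 x0 a0 bigo_const)
  have "(\<lambda>n. (of_int (k n) - e0 n / si) + e0 n / si) \<in> O(\<lambda>_. 1)"
    unfolding k_def by (intro sum_in_bigo floor_minus_bigo_1 e0)
  then have k: "(\<lambda>n. real_of_int (k n)) \<in> O(\<lambda>_. 1)" by simp
  define x where "x n = \<lfloor>xi * N n\<rfloor> - k n" for n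
  define a where "a n = \<lfloor>al * N n\<rfloor> + 2 * k n" for n
  define x1 where "x1 n = x0 n - of_int (k n)" for n
  define a1 where "a1 n = a0 n + 2 * of_int (k n)" for n
  have x1: "x1 \<in> O(\<lambda>_. 1)" unfolding x1_def by (intro closure x0 k)
  have a1: "a1 \<in> O(\<lambda>_. 1)" unfolding a1_def by (intro closure a0 k bigo_const)
  have e: "(2 + lam) * d1 n - al * x1 n - 2 * lam * a1 n + 2 * al + lam - 1 = e0 n - of_int (k n) * si" for n
    by (simp add: x1_def a1_def e0_def si_def algebra_simps)
  have k_bounds: "of_int (k n) * si \<le> e0 n" "e0 n \<le> of_int (k n) * si + si" for n
    using floor_divide_lower[OF si, of "e0 n"] floor_divide_upper[OF si, of "e0 n"]
    by (simp_all add: k_def algebra_simps)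
  define n0 where "n0 n = al * x1 n + xi * a1 n + lam * (d1 n - a1 n) + al + lam" for n
  have n0: "n0 \<in> O(\<lambda>_. 1)" unfolding n0_def by (intro closure x1 a1 d1 bigo_const)
  define b where "b n = \<lfloor>lam * N n + 2 - n0 n / et\<rfloor>" for n
  define b1 where "b1 n = of_int (b n) - lam * N n" for n
  have "(\<lambda>n. (of_int (b n) - (lam * N n + 2 - n0 n / et)) + (2 - n0 n * inverse et)) \<in> O(\<lambda>_. 1)"
    unfolding b_def by (intro closure floor_minus_bigo_1 n0 bigo_const)
  then have b1: "b1 \<in> O(\<lambda>_. 1)" by (simp add: b1_def[abs_def] divide_inverse)
  have "1 - n0 n / et \<le> b1 n" "b1 n \<le> 2 - n0 n / et" for n
    using floor_correct[of "lam * N n + 2 - n0 n / et"] unfolding b1_def b_def by linarith+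
  then have "et * (1 - n0 n / et) \<le> et * b1 n" "et * b1 n \<le> et * (2 - n0 n / et)" for n
    using et by (auto intro!: mult_left_mono)
  then have nu: "et \<le> n0 n + et * b1 n" "n0 n + et * b1 n \<le> 2 * et" for n
    using et by (auto simp: algebra_simps)
  show ?thesis
  proof (rule that[of a a1 b b1 x x1 d d1])
    show "ka - al \<le> al * x1 n + xi * a1 n + lam * (d1 n - a1 n) + (ka - al) * b1 n + al + lam"
         "al * x1 n + xi * a1 n + lam * (d1 n - a1 n) + (ka - al) * b1 n + al + lam \<le> 2 * (ka - al)" for n
      using nu[of n] by (simp_all add: n0_def et_def algebra_simps)
    show "0 \<le> (2 + lam) * d1 n - al * x1 n - 2 * lam * a1 n + 2 * al + lam - 1"
         "(2 + lam) * d1 n - al * x1 n - 2 * lam * a1 n + 2 * al + lam - 1 \<le> 4 * lam - al" for n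
      using k_bounds[of n] unfolding e si_def[symmetric] by linarith+
  qed (use a1 b1 x1 d1 in \<open>auto simp: a_def a1_def a0_def b1_def x_def x1_def x0_def d1_def\<close>)
qed

text \<open>
  The target is \<open>Q = N + c + 1\<close>. Expanded in powers of \<open>N\<close>, each hypothesis of \<open>F_bip_ge\<close>
  becomes an inequality between coefficients of \<open>N\<close>, with a bounded remainder. The condition
  at the second core set reads \<open>c ka < v\<close>, the one at the first reads \<open>c ka < v + ex\<close> with
  \<open>ex \<ge> 0\<close> the discrepancy; the choice \<open>c ka = v - ta\<close> leaves room for the remainders.
  The ratio is then \<open>N/4 + (2 (c + 1) - S) / 8\<close> up to an error that tends to \<open>0\<close>, where \<open>S\<close> is the
  coefficient of \<open>N\<close> in \<open>a b - a - b\<close>. Both \<open>2 c\<close> and \<open>S\<close> vary with the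
  corrections \<open>a1\<close> and \<open>b1\<close>, but the combination \<open>al b1 + lam a1\<close> through which they do so
  cancels in the difference. What remains involves, besides the fixed coefficients, only the
  quantities \<open>nn\<close>, \<open>ex\<close> and \<open>ta\<close>; this is why bounded changes of the parameters are almost free.
\<close>

lemma F_bip_ge_eventually:
  fixes lam ta :: real
  assumes lam: "1 / 2 < lam" "lam < 1" and ta: "ta > 0"
  defines "al \<equiv> 1 / lam" and "ka \<equiv> 3 / (1 + lam)"
  shows "\<forall>\<^sub>F n in sequentially.
    (2 + al + lam - (1 + al + 2 * (ka - al) + (4 * lam - al) + 2 * ta) / ka) / 8 - ta
      \<le> F_bip n - sqrt (real n) / 4"
proof -
  define xi where "xi = lam * ka - lam"
  define N where "N n = sqrt (real n)" for n
  obtain a b x d :: "nat \<Rightarrow> int" and a1 b1 x1 d1 :: "nat \<Rightarrow> real"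
  where a: "\<And>n. real_of_int (a n) = al * N n + a1 n" and b: "\<And>n. real_of_int (b n) = lam * N n + b1 n"
    and x: "\<And>n. real_of_int (x n) = xi * N n + x1 n" and d: "\<And>n. real_of_int (d n) = ka * N n + d1 n"
    and a1: "a1 \<in> O(\<lambda>_. 1)" and b1: "b1 \<in> O(\<lambda>_. 1)" and x1: "x1 \<in> O(\<lambda>_. 1)" and d1: "d1 \<in> O(\<lambda>_. 1)"
    and E: "\<And>n. 0 \<le> (2 + lam) * d1 n - al * x1 n - 2 * lam * a1 n + 2 * al + lam - 1"
    "\<And>n. (2 + lam) * d1 n - al * x1 n - 2 * lam * a1 n + 2 * al + lam - 1 \<le> 4 * lam - al"
    and nu: "\<And>n. ka - al \<le> al * x1 n + xi * a1 n + lam * (d1 n - a1 n) + (ka - al) * b1 n + al + lam"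
    "\<And>n. al * x1 n + xi * a1 n + lam * (d1 n - a1 n) + (ka - al) * b1 n + al + lam \<le> 2 * (ka - al)"
    by (rule bounded_core_parameters[where N = N, OF lam meta_eq_to_obj_eq[OF al_def] meta_eq_to_obj_eq[OF ka_def] xi_def])
      (rule that; assumption)
  have al: "al * lam = 1" using lam by (simp add: al_def)
  have ka: "ka * (1 + lam) = 3" "ka > 3 / 2" "ka < 2" using lam by (auto simp: ka_def field_simps)
  have "1 / lam < 3 / (1 + lam)" "6 / (1 + lam) < 3 / lam"
    using lam by (simp_all add: pos_divide_less_eq pos_less_divide_eq)
  then have et: "ka - al > 0" "2 * (ka - al) < al" by (simp_all add: ka_def al_def)
  have de: "lam * ka > 1" using lam by (simp add: ka_def field_simps)
  have xi: "xi > 0" using lam ka by (simp add: xi_def)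
  \<comment> \<open>\<open>nn\<close> is the coefficient of \<open>N\<close> in the number of surplus leaves. The sequences named with \<open>R\<close>
    are the bounded remainders in the number of vertices (\<open>R\<close>), in the conditions at the two core
    sets (\<open>RA\<close>, \<open>RB\<close>), in \<open>a b - a - b\<close> (\<open>R2\<close>), and in the final comparison of ratios
    (\<open>R3\<close>, \<open>R4\<close>).\<close>
  define D1 where "D1 n = x1 n + b1 n" for n
  define ex where "ex n = (2 + lam) * d1 n - al * x1 n - 2 * lam * a1 n + 2 * al + lam - 1" for n
  define nn where "nn n = al * x1 n + xi * a1 n + lam * (d1 n - a1 n) + (ka - al) * b1 n + al + lam" for n
  define v where "v n = al * D1 n - d1 n + lam * ka * a1 n - al - nn n" for n
  define c where "c n = (v n - ta) * inverse ka" for n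
  define R where "R n = a1 n + b1 n + a1 n * x1 n + b1 n * (d1 n - a1 n)" for n
  define RA where "RA n = b1 n * (d1 n - 1) - c n * D1 n" for n
  define RB where "RB n = a1 n * (D1 n - 1) - R n - c n * d1 n" for n
  define S where "S n = al * b1 n + lam * a1 n - al - lam" for n
  define R2 where "R2 n = a1 n * b1 n - a1 n - b1 n" for n
  define g where "g n = (2 * (c n + 1) - S n) * inverse 8 - ta" for n
  define R3 where "R3 n = R2 n * inverse 2 + 2 * S n * g n" for n
  define R4 where "R4 n = 2 * R2 n * g n" for n
  note closure = landau_o.big.mult_in_1 sum_in_bigo bigo_const
  have D1: "D1 \<in> O(\<lambda>_. 1)" unfolding D1_def by (intro closure b1 x1)
  have nn: "nn \<in> O(\<lambda>_. 1)" unfolding nn_def by (intro closure a1 b1 x1 d1)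
  have v: "v \<in> O(\<lambda>_. 1)" unfolding v_def by (intro closure a1 D1 d1 nn)
  have c: "c \<in> O(\<lambda>_. 1)" unfolding c_def by (intro closure v)
  have R: "R \<in> O(\<lambda>_. 1)" unfolding R_def by (intro closure a1 b1 x1 d1)
  have RA: "RA \<in> O(\<lambda>_. 1)" unfolding RA_def by (intro closure D1 b1 c d1)
  have RB: "RB \<in> O(\<lambda>_. 1)" unfolding RB_def by (intro closure D1 a1 c d1 R)
  have S: "S \<in> O(\<lambda>_. 1)" unfolding S_def by (intro closure a1 b1)
  have R2: "R2 \<in> O(\<lambda>_. 1)" unfolding R2_def by (intro closure a1 b1)
  have g: "g \<in> O(\<lambda>_. 1)" unfolding g_def by (intro closure c S)
  have R3: "R3 \<in> O(\<lambda>_. 1)" unfolding R3_def by (intro closure R2 S g)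
  have R4: "R4 \<in> O(\<lambda>_. 1)" unfolding R4_def by (intro closure R2 g)
  have Ntop: "filterlim N at_top sequentially"
    unfolding N_def by (intro filterlim_compose[OF sqrt_at_top] filterlim_real_sequentially)
  have small: "\<forall>\<^sub>F n in sequentially. \<bar>f n\<bar> \<le> e * N n" if f: "f \<in> O(\<lambda>_. 1)" and "e > 0" for f e
  proof -
    obtain C where C: "\<forall>\<^sub>F n in sequentially. norm (f n) \<le> C * norm (1::real)"
      using landau_o.bigE[OF f] by blast
    have "\<forall>\<^sub>F n in sequentially. N n \<ge> C / e"
      using Ntop by (simp add: filterlim_at_top)
    with C show ?thesis
    proof eventually_elim
      case (elim n)
      then show ?case using \<open>e > 0\<close> by (simp add: field_simps)
    qed
  qed
  have cka: "c n * ka = v n - ta" for n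
    using ka by (simp add: c_def mult.assoc)
  have gbound: "(2 + al + lam - (1 + al + 2 * (ka - al) + (4 * lam - al) + 2 * ta) / ka) / 8 - ta \<le> g n" for n
  proof -
    have "2 * v n = ka * (al * b1 n + lam * a1 n) - 1 - al - nn n - ex n"
      unfolding v_def ex_def nn_def D1_def xi_def using al ka(1) by algebra
    then have "2 * (c n * ka) = ka * (al * b1 n + lam * a1 n) - 1 - al - nn n - ex n - 2 * ta"
      using cka[of n] by simp
    moreover have "nn n \<le> 2 * (ka - al)" "ex n \<le> 4 * lam - al"
      using nu(2)[of n] E(2)[of n] by (auto simp: nn_def ex_def)
    ultimately have "ka * (al + lam - (2 * c n - S n)) \<le> 1 + al + 2 * (ka - al) + (4 * lam - al) + 2 * ta"
      by (simp add: S_def algebra_simps)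
    moreover define w where "w = (1 + al + 2 * (ka - al) + (4 * lam - al) + 2 * ta) / ka"
    ultimately have "al + lam - (2 * c n - S n) \<le> w"
      using ka by (simp add: pos_le_divide_eq mult.commute)
    then show ?thesis unfolding w_def[symmetric] g_def by simp
  qed
  \<comment> \<open>The slacks in the leading coefficients. A bounded sequence is eventually at most \<open>e N\<close> in
    absolute value, so that these slacks absorb all remainders.\<close>
  define margins where "margins = {(ka - al) / 2, (al - 2 * (ka - al)) / 2, lam * ta, ta,
    (lam * ka - 1) / 4, xi / 2, lam / 2, 1 / 4}"
  define e where "e = Min margins"
  have fin: "finite margins" "margins \<noteq> {}" by (simp_all add: margins_def)
  have "\<forall>t\<in>margins. t > 0" unfolding margins_def using et lam ta de xi by simp
  then have e0: "e > 0" unfolding e_def using fin by (simp add: Min_gr_iff)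
  have "e \<le> t" if "t \<in> margins" for t unfolding e_def using fin(1) that by (rule Min_le)
  then have e: "e > 0" "e \<le> (ka - al) / 2" "e \<le> (al - 2 * (ka - al)) / 2" "e \<le> lam * ta" "e \<le> ta"
    "e \<le> (lam * ka - 1) / 4" "e \<le> xi / 2" "e \<le> lam / 2" "e \<le> 1 / 4"
    using e0 unfolding margins_def by blast+
  show ?thesis
    using small[OF a1 e(1)] small[OF R e(1)] small[OF RA e(1)] small[OF RB e(1)] small[OF R3 e(1)]
      small[OF R4 e(1)] small[OF b1 e(1)] small[OF x1 e(1)] small[OF d1 e(1)] small[OF c e(1)]
      small[OF S e(1)] small[OF R2 e(1)] small[OF D1 e(1)] small[OF bigo_const[of 1] e(1)]
  proof eventually_elim
    case (elim n)
    define w where "w = e * N n"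
    note bounds = elim[folded w_def]
    have N1: "1 \<le> w" using bounds(14) by simp
    have N0: "N n > 0" using N1 e(1) unfolding w_def by (smt (verit) mult_nonneg_nonpos)
    have N2: "N n * N n = real n" by (simp add: N_def)
    have lin: "w \<le> t * N n" if "e \<le> t" for t using that N0 by (simp add: w_def)
    have w: "2 * w \<le> ka * N n - al * N n" "2 * w \<le> 3 * al * N n - 2 * ka * N n"
      "w \<le> lam * ta * N n" "w \<le> ta * N n" "4 * w \<le> lam * ka * N n - N n" "2 * w \<le> xi * N n"
      "2 * w \<le> lam * N n" "4 * w \<le> N n"
      using e(2-9)[THEN lin] by (simp_all add: algebra_simps)
    have xi': "xi + lam = lam * ka" by (simp add: xi_def)
    have apos: "1 \<le> real_of_int (a n)"
      using bounds(1) N1 w(1,2) a[of n] by (simp add: abs_le_iff)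
    have bpos: "1 \<le> real_of_int (b n)"
      using bounds(7) N1 w(7) b[of n] by (simp add: abs_le_iff)
    have xpos: "1 \<le> real_of_int (x n)"
      using bounds(8) N1 w(6) x[of n] by (simp add: abs_le_iff)
    have ypos: "0 \<le> real_of_int (d n - a n)"
      using bounds(1,9) w(1) a[of n] d[of n]
      by (simp add: abs_le_iff algebra_simps)
    define aa bb xx yy where "aa = nat (a n)" and "bb = nat (b n)" and "xx = nat (x n)" and "yy = nat (d n - a n)"
    have aa: "real aa = al * N n + a1 n" using apos a[of n] by (simp add: aa_def)
    have bb: "real bb = lam * N n + b1 n" using bpos b[of n] by (simp add: bb_def)
    have xx: "real xx = xi * N n + x1 n" using xpos x[of n] by (simp add: xx_def)
    have yy: "real aa + real yy = ka * N n + d1 n"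
      using apos ypos d[of n] by (simp add: aa_def yy_def)
    have D: "real bb + real xx = lam * ka * N n + D1 n"
      using bb xx xi' by (simp add: D1_def algebra_simps flip: distrib_right)
    define Q where "Q = N n + c n + 1"
    have n0: "real aa + real bb + real aa * real xx + real bb * real yy = N n * N n + nn n * N n + R n"
    proof -
      have "real yy = (ka - al) * N n + (d1 n - a1 n)" using yy aa by (simp add: algebra_simps)
      then show ?thesis unfolding aa bb xx R_def nn_def xi_def using al ka(1) by algebra
    qed
    have nn_bounds: "ka * N n - al * N n \<le> nn n * N n" "nn n * N n \<le> 2 * ka * N n - 2 * al * N n"
      using mult_right_mono[OF nu(1)[of n], of "N n"] mult_right_mono[OF nu(2)[of n], of "N n"] N0
      unfolding nn_def[symmetric] by (simp_all add: left_diff_distrib)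
    have ex0: "ex n \<ge> 0" using E(1)[of n] by (simp add: ex_def)
    have "Q * n / (2 * (real n + real aa * real bb - real aa - real bb)) \<le> F_bip n"
    proof (rule F_bip_ge[of aa bb xx yy n Q])
      show "1 \<le> aa" "1 \<le> bb" "1 \<le> xx"
        using apos bpos xpos by (simp_all add: aa_def bb_def xx_def le_nat_iff)
      then have xx1: "real (xx - 1) = real xx - 1" by (simp add: of_nat_diff)
      have "real (aa + bb + aa * (xx - 1) + bb * yy)
          = (real aa + real bb + real aa * real xx + real bb * real yy) - real aa"
        unfolding of_nat_add of_nat_mult xx1 by algebra
      also have "\<dots> = N n * N n + nn n * N n + R n - (al * N n + a1 n)" by (simp only: n0) (simp only: aa)
      also have "\<dots> \<le> real n"
        using nn_bounds bounds(1,2) w(2) N2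
        by (simp add: abs_le_iff algebra_simps)
      finally have "real (aa + bb + aa * (xx - 1) + bb * yy) \<le> real n" .
      then show "aa + bb + aa * (xx - 1) + bb * yy \<le> n" by (simp only: of_nat_le_iff)
      have "real n \<le> real (aa + bb + aa * xx + bb * yy)"
        using n0 nn_bounds bounds(2) w(1) N1 N2 by (simp add: abs_le_iff)
      then show "n \<le> aa + bb + aa * xx + bb * yy" by (simp only: of_nat_le_iff)
      show "1 \<le> Q" using bounds(10) w(8) N1 by (simp add: Q_def abs_le_iff)
      show "Q \<le> real bb + real xx - 1"
        using bounds(10,13) w(5) N1 unfolding Q_def D
        by (simp add: abs_le_iff algebra_simps)
      have "lam * ka * N n \<le> ka * N n" using lam ka N0 by simp
      then show "Q \<le> real aa + real yy"
        using bounds(9,10) w(5) N1 unfolding Q_def yy by (simp add: abs_le_iff algebra_simps)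
      have "real bb * (real aa + real yy - 1) - (Q - 1) * (real bb + real xx)
          = lam * (ex n + ta) * N n + RA n"
        unfolding D yy unfolding bb Q_def RA_def ex_def using al ka(1) cka[of n]
        unfolding v_def nn_def D1_def xi_def by algebra
      moreover have "lam * ta * N n \<le> lam * (ex n + ta) * N n"
        using ex0 lam N0 by (intro mult_right_mono mult_left_mono) auto
      ultimately show "(Q - 1) * (real bb + real xx) \<le> real bb * (real aa + real yy - 1)"
        using bounds(3) w(3) by (simp add: abs_le_iff)
      have "real aa * (real bb + real xx - 1) - (real aa + real bb + real aa * real xx + real bb * real yy - real n)
          - (Q - 1) * (real aa + real yy) = ta * N n + RB n"
        unfolding n0 unfolding D yy unfolding aa Q_def RB_def using al ka(1) cka[of n] N2
        unfolding v_def by algebra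
      then show "(Q - 1) * (real aa + real yy) \<le> real aa * (real bb + real xx - 1) -
          (real aa + real bb + real aa * real xx + real bb * real yy - real n)"
        using bounds(4) w(4) by (simp add: abs_le_iff)
    qed
    moreover have "N n / 4 + g n \<le> Q * n / (2 * (real n + real aa * real bb - real aa - real bb))"
    proof -
      have den: "real n + real aa * real bb - real aa - real bb = 2 * (N n * N n) + S n * N n + R2 n"
        unfolding aa bb S_def R2_def N2[symmetric] using al by algebra
      have N4: "N n \<ge> 4" using w(8) N1 by simp
      have sq: "t * N n \<le> t * (N n * N n)" if "t \<ge> 0" for t
        using that N4 by (intro mult_left_mono) auto
      have "\<bar>S n * N n\<bar> \<le> 1 / 4 * (N n * N n)"
        using mult_right_mono[of "\<bar>S n\<bar>" "1 / 4 * N n" "N n"] bounds(11) w(8) N0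
        by (simp add: abs_mult)
      moreover have "\<bar>R2 n\<bar> \<le> 1 / 4 * (N n * N n)"
        using bounds(12) w(8) sq[of "1 / 4"] by simp
      ultimately have pos: "2 * (N n * N n) + S n * N n + R2 n > 0"
        using mult_pos_pos[OF N0 N0] by (simp add: abs_le_iff)
      have "\<bar>R3 n * N n\<bar> \<le> ta * (N n * N n)"
        using mult_right_mono[of "\<bar>R3 n\<bar>" "ta * N n" "N n"] bounds(5) w(4) N0
        by (simp add: abs_mult)
      moreover have "\<bar>R4 n\<bar> \<le> ta * (N n * N n)"
        using bounds(6) w(4) sq[of ta] ta by linarith
      moreover have "Q * real n - (N n / 4 + g n) * (2 * (2 * (N n * N n) + S n * N n + R2 n))
          = 4 * ta * (N n * N n) - R3 n * N n - R4 n"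
        unfolding Q_def N2[symmetric] R3_def R4_def g_def by (simp add: field_simps)
      moreover have "ta * (N n * N n) \<ge> 0" using ta N0 by simp
      ultimately have "(N n / 4 + g n) * (2 * (2 * (N n * N n) + S n * N n + R2 n)) \<le> Q * real n"
        by (simp add: abs_le_iff)
      then show ?thesis unfolding den using pos by (simp add: pos_le_divide_eq)
    qed
    ultimately show ?case using gbound[of n] by (simp add: N_def)
  qed
qed

text \<open>
  The guaranteed constant of \<open>F_bip_ge_eventually\<close>, with \<open>ta = lam - 1/2\<close>, is continuous in \<open>lam\<close>
  and equals \<open>3/8\<close> at \<open>lam = 1/2\<close>. That value itself
  is not available, because there both step lengths in \<open>bounded_core_parameters\<close> are zero.
\<close>

lemma F_bip_minus_sqrt_gt:
  assumes "l < 3 / 8"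
  shows "\<forall>\<^sub>F n in sequentially. l < F_bip n - sqrt (real n) / 4"
proof -
  define f :: "real \<Rightarrow> real" where
    "f lam = (2 + 1 / lam + lam - (1 + 1 / lam + 2 * (3 / (1 + lam) - 1 / lam) + (4 * lam - 1 / lam)
      + 2 * (lam - 1 / 2)) / (3 / (1 + lam))) / 8 - (lam - 1 / 2)" for lam
  have "(f \<longlongrightarrow> 3 / 8) (at_right (1 / 2))"
    unfolding f_def by (auto intro!: tendsto_eq_intros)
  then have "\<forall>\<^sub>F lam in at_right (1 / 2). l < f lam"
    using assms by (rule order_tendstoD)
  moreover have "\<forall>\<^sub>F lam in at_right (1 / 2 :: real). lam \<in> {1 / 2<..<1}"
    by (rule eventually_at_right_real) simp
  ultimately have "\<forall>\<^sub>F lam in at_right (1 / 2). l < f lam \<and> lam \<in> {1 / 2<..<1}"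
    by (rule eventually_conj)
  then obtain lam where lam: "l < f lam" "1 / 2 < lam" "lam < 1"
    using eventually_happens[of _ "at_right (1 / 2 :: real)"] by force
  have "\<forall>\<^sub>F n in sequentially. f lam \<le> F_bip n - sqrt (real n) / 4"
    using F_bip_ge_eventually[OF lam(2,3), of "lam - 1 / 2"] lam(2) unfolding f_def by simp
  then show ?thesis by eventually_elim (use lam(1) in simp)
qed

theorem theorem1p1:
  shows "(\<lambda>n. F_bip n - sqrt (real n) / 4) \<longlonglongrightarrow> 3 / 8"
  by (rule order_tendstoI) (fact F_bip_minus_sqrt_gt F_bip_minus_sqrt_lt)+

end
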